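(* Let $A\in\mathbb{R}^{N\times N}$ be a symmetric positive semidefinite matrix such that $-A$ is a discretized Laplacian, let $\epsilon>0$, and let the EE2 scheme be applied to solve the space-discretized Cahn–Hilliard initial value problem $$y'(t)=-A\left(F'(y(t))+\epsilon^2Ay(t)\right),\qquad y(0)=y^0\in\mathbb{R}^N,$$ where $F'(c)=c(c^2-1)$ is applied elementwise. Let the exact solution $y(t)$ of this initial value problem be Lipschitz continuous. Then for the local error $e^n$ of the EE2 scheme at time step $n$ it holds $$e^n=\mathcal{O}(\tau^3),$$ where $\tau$ is the time step size and the leading term is proportional to $\|A\|$.
   Context: $\|\cdot\|$ denotes the Euclidean vector or matrix norm. EE2 (exponential Euler order 2) scheme. Given the numerical solution $y^n\approx y(t_n)$ and a time step size $\tau>0$, let $J_n=3\operatorname{diag}\left((y_1^n)^2,\dots,(y_N^n)^2\right)-I$ (the Jacobian of the mapping $F'$ at $y^n$, with $I$ the $N\times N$ identity matrix), $\widehat{A}_n=A(J_n+\epsilon^2A)$ and $\widehat{g}^n=A(J_ny^n-F'(y^n))$. The scheme solves the linear initial value problem $$\tilde{y}'(t)=-\widehat{A}_n\tilde{y}(t)+\widehat{g}^n,\quad t\in[t_n,t_n+\tau],\qquad \tilde{y}(t_n)=y^n,$$ and sets $y^{n+1}:=\tilde{y}(t_n+\tau)$, $t_{n+1}=t_n+\tau$. Equivalently, $y^{n+1}=y^n+\tau\varphi(-\tau\widehat{A}_n)(\widehat{g}^n-\widehat{A}_ny^n)$, where $\varphi(z)=(e^z-1)/z$, $\varphi(0)=1$.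 Local error. The local error $e^{n+1}$ is defined as $e^{n+1}=y(t_{n+1})-\tilde{y}(t_{n+1})$, where $\tilde{y}(t_{n+1})$ is obtained by one EE2 step of size $\tau$ started from the exact value $y^n=y(t_n)$; correspondingly, $e^n$ is the local error of the step from $t_{n-1}$ to $t_n$. *)

theory Defs
  imports "HOL-Analysis.Analysis"
begin

definition Fprime :: "real ^ 'n \<Rightarrow> real ^ 'n"
  where "Fprime y = (\<chi> i. y $ i * ((y $ i)\<^sup>2 - 1))"

definition diag_mat :: "real ^ 'n \<Rightarrow> real ^ 'n ^ 'n"
  where "diag_mat d = (\<chi> i j. if i = j then d $ i else 0)"

definition Fprime_jacobian :: "real ^ 'n \<Rightarrow> real ^ 'n ^ 'n"
  where "Fprime_jacobian v = 3 *\<^sub>R diag_mat (\<chi> i. (v $ i)\<^sup>2) - mat 1"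

(* The discretized Laplacian is -A. Which discretization is used (grid, boundary conditions,
   stencil) is left open; only symmetry and positive semidefiniteness of A are required. *)
definition psd_matrix :: "real ^ 'n ^ 'n \<Rightarrow> bool"
  where "psd_matrix A \<longleftrightarrow> transpose A = A \<and> (\<forall>x. 0 \<le> x \<bullet> (A *v x))"

(* The library norm on real ^ 'n ^ 'n is the Frobenius norm, so the matrix norm
   induced by the Euclidean vector norm has to be written as an operator norm. *)
definition matrix_norm :: "real ^ 'n ^ 'n \<Rightarrow> real"
  where "matrix_norm A = onorm (\<lambda>x. A *v x)"

(* The derivative is one-sided at the end points of {0..T}. *)
definition cahn_hilliard_solution ::
    "real ^ 'n ^ 'n \<Rightarrow> real \<Rightarrow> real ^ 'n \<Rightarrow> real \<Rightarrow> (real \<Rightarrow> real ^ 'n) \<Rightarrow> bool"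
  where "cahn_hilliard_solution A \<epsilon> y0 T y \<longleftrightarrow>
    y 0 = y0 \<and>
    (\<forall>t\<in>{0..T}. (y has_vector_derivative
        - (A *v (Fprime (y t) + \<epsilon>\<^sup>2 *\<^sub>R (A *v y t)))) (at t within {0..T}))"

definition EE2_matrix :: "real ^ 'n ^ 'n \<Rightarrow> real \<Rightarrow> real ^ 'n \<Rightarrow> real ^ 'n ^ 'n"
  where "EE2_matrix A \<epsilon> v = A ** (Fprime_jacobian v + \<epsilon>\<^sup>2 *\<^sub>R A)"

definition EE2_vector :: "real ^ 'n ^ 'n \<Rightarrow> real ^ 'n \<Rightarrow> real ^ 'n"
  where "EE2_vector A v = A *v (Fprime_jacobian v *v v - Fprime v)"

definition EE2_ivp ::
    "real ^ 'n ^ 'n \<Rightarrow> real \<Rightarrow> real \<Rightarrow> real \<Rightarrow> real ^ 'n \<Rightarrow> (real \<Rightarrow> real ^ 'n) \<Rightarrow> bool"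
  where "EE2_ivp A \<epsilon> t \<tau> v u \<longleftrightarrow>
    u t = v \<and>
    (\<forall>s\<in>{t..t + \<tau>}. (u has_vector_derivative
        - (EE2_matrix A \<epsilon> v *v u s) + EE2_vector A v) (at s within {t..t + \<tau>}))"

(* The problem is linear with constant coefficients, so for \<tau> \<ge> 0 the solution exists on
   {t..t + \<tau>} and is unique there: the description below denotes its end value. *)
definition EE2_step :: "real ^ 'n ^ 'n \<Rightarrow> real \<Rightarrow> real \<Rightarrow> real \<Rightarrow> real ^ 'n \<Rightarrow> real ^ 'n"
  where "EE2_step A \<epsilon> t \<tau> v = (THE z. \<exists>u. EE2_ivp A \<epsilon> t \<tau> v u \<and> z = u (t + \<tau>))"

(* Error of one step of size \<tau> started at time t from the exact value y t. *)
definition EE2_local_error ::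
    "real ^ 'n ^ 'n \<Rightarrow> real \<Rightarrow> (real \<Rightarrow> real ^ 'n) \<Rightarrow> real \<Rightarrow> real \<Rightarrow> real ^ 'n"
  where "EE2_local_error A \<epsilon> y t \<tau> = y (t + \<tau>) - EE2_step A \<epsilon> t \<tau> (y t)"

end

theory Submission
  imports Defs
begin

text \<open>
  Write the equation as \<open>y' = f(y)\<close> with \<open>f(y) = -A(F'(y) + \<epsilon>\<^sup>2 A y)\<close>. A step of the scheme
  from \<open>v = y(t)\<close> solves the linearized problem \<open>u' = f(v) + Df(v)(u - v)\<close> exactly
  (\<open>EE2_rhs\<close>), so the error \<open>e = y - u\<close> is driven by the Taylor remainder of \<open>f\<close> alone.
  As \<open>F'\<close> is a cubic acting componentwise, that remainder is the explicit expression
  \<open>-A(3 v d\<^sup>2 + d\<^sup>3)\<close> with \<open>d = y - v\<close> and componentwise products (\<open>CH_field_taylor\<close>).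

  Let \<open>p = y'(t)\<close>. At time \<open>t + s\<close> one has \<open>d = s p + O(s\<^sup>2)\<close>, hence \<open>3 v d\<^sup>2 + d\<^sup>3 =
  3 s\<^sup>2 v p\<^sup>2 + O(s\<^sup>3)\<close> (\<open>quadratic_remainder_bound\<close>), and integration gives
  \<open>e = -s\<^sup>3 A(v p\<^sup>2) + O(s\<^sup>4)\<close>. To make this rigorous, one subtracts the expected leading term:
  \<open>h = e + s\<^sup>3 A(v p\<^sup>2)\<close> satisfies \<open>h(0) = 0\<close> and \<open>\<parallel>h'\<parallel> \<le> a \<parallel>h\<parallel> + O(\<tau>\<^sup>3)\<close> on a step of
  length \<open>\<tau>\<close>. For \<open>a \<tau> \<le> 1/2\<close> this forces \<open>h(\<tau>) = O(\<tau>\<^sup>4)\<close> (\<open>short_time_bound\<close>); the result is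
  \<open>EE2_local_error_expansion\<close>.

  The leading coefficient is thus \<open>-A(v p\<^sup>2)\<close>. Its norm is at most \<open>\<parallel>A\<parallel> \<parallel>v\<parallel> \<parallel>p\<parallel>\<^sup>2\<close>, where
  \<open>\<parallel>p\<parallel> \<le> L\<close> by Lipschitz continuity and \<open>\<parallel>v\<parallel> \<le> \<parallel>y0\<parallel> + L T\<close>. So after division by \<open>\<parallel>A\<parallel>\<close> it is
  bounded independently of \<open>A\<close> and \<open>\<epsilon>\<close>, which is the proportionality to \<open>\<parallel>A\<parallel>\<close>.

  The scheme is defined as the end value of an initial value problem, so existence and uniqueness
  for that problem enter as well. Existence comes from the exponential series
  (\<open>affine_ode_solution_exists\<close>); uniqueness on short steps is \<open>short_time_bound\<close> without forcing.
\<close>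

section \<open>Ordinary differential equations and differentiable curves\<close>

text \<open>
  If \<open>x\<close> solves the equation, its derivatives at \<open>0\<close> are \<open>c 0 = v\<close> and
  \<open>c (k + 1) = B\<^sup>k (B v + g)\<close>, so the Taylor series \<open>\<Sum> s\<^sup>k c k / k!\<close> is the candidate. It is
  differentiated coordinatewise, where the theorem on real power series applies.
\<close>

lemma affine_ode_solution_exists:
  fixes B :: "'a::euclidean_space \<Rightarrow> 'a"
  assumes B: "bounded_linear B"
  obtains x where "x 0 = v" "\<And>s. (x has_vector_derivative B (x s) + g) (at s)"
proof -
  interpret B: bounded_linear B by (rule B)
  define c where "c k = (case k of 0 \<Rightarrow> v | Suc j \<Rightarrow> (B ^^ j) (B v + g))" for k
  have c_0: "c 0 = v" by (simp add: c_def)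
  have c_Suc: "c (Suc k) = B (c k) + (if k = 0 then g else 0)" for k
    by (cases k) (simp_all add: c_def)
  define m where "m = onorm B"
  define M where "M = norm v + norm (B v + g)"
  have m: "0 \<le> m" unfolding m_def by (rule onorm_pos_le[OF B])
  have Bm: "norm (B z) \<le> m * norm z" for z unfolding m_def by (rule onorm[OF B])
  have pow: "norm ((B ^^ k) z) \<le> m ^ k * norm z" for k z
  proof (induction k)
    case (Suc k)
    have "norm (B ((B ^^ k) z)) \<le> m * norm ((B ^^ k) z)" by (rule Bm)
    also have "\<dots> \<le> m * (m ^ k * norm z)" by (rule mult_left_mono[OF Suc m])
    finally show ?case by (simp add: mult_ac)
  qed simp
  \<comment> \<open>The base \<open>1 + m\<close> instead of \<open>m\<close> keeps the bound valid at index \<open>k\<close>, although \<open>c k\<close>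
    contains only \<open>k - 1\<close> factors \<open>B\<close>.\<close>
  have c_bound: "norm (c k) \<le> M * (1 + m) ^ k" for k
  proof (cases k)
    case 0
    then show ?thesis by (simp add: c_def M_def)
  next
    case (Suc j)
    have "norm (c k) \<le> m ^ j * norm (B v + g)" using pow[of j] by (simp add: c_def Suc)
    also have "\<dots> \<le> (1 + m) ^ k * M"
      using m unfolding Suc M_def
      by (intro mult_mono order.trans[OF power_mono[of m "1 + m" j]] power_increasing) auto
    finally show ?thesis by (simp add: mult_ac)
  qed
  have summable_c: "summable (\<lambda>k. (s ^ k / fact k) *\<^sub>R c k)" for s
  proof (rule summable_comparison_test')
    show "summable (\<lambda>k. M * (inverse (fact k) * ((1 + m) * \<bar>s\<bar>) ^ k))"
      by (intro summable_mult summable_exp)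
    show "norm ((s ^ k / fact k) *\<^sub>R c k) \<le> M * (inverse (fact k) * ((1 + m) * \<bar>s\<bar>) ^ k)" for k
      using mult_left_mono[OF c_bound[of k], of "\<bar>s\<bar> ^ k / fact k"]
      by (simp add: abs_mult power_abs power_mult_distrib divide_inverse mult_ac)
  qed
  define x where "x s = (\<Sum>k. (s ^ k / fact k) *\<^sub>R c k)" for s :: real
  have x_sums: "(\<lambda>k. (s ^ k / fact k) *\<^sub>R c k) sums x s" for s
    unfolding x_def by (rule summable_sums[OF summable_c])
  have x'_sums: "(\<lambda>k. (s ^ k / fact k) *\<^sub>R c (Suc k)) sums (B (x s) + g)" for s
  proof -
    have "(\<lambda>k. (s ^ k / fact k) *\<^sub>R B (c k) + (if k = 0 then g else 0)) sums (B (x s) + g)"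
      using sums_add[OF B.sums[OF x_sums] sums_single[of 0 "\<lambda>_. g"]] by (simp add: B.scaleR)
    moreover have "(s ^ k / fact k) *\<^sub>R c (Suc k) =
        (s ^ k / fact k) *\<^sub>R B (c k) + (if k = 0 then g else 0)" for k
      by (simp add: c_Suc scaleR_right_distrib)
    ultimately show ?thesis by simp
  qed
  have "x 0 = v"
  proof -
    have "(\<lambda>k. (0 ^ k / fact k) *\<^sub>R c k) = (\<lambda>k. if k = 0 then v else 0)"
      by (auto simp: c_0)
    then show ?thesis
      using x_sums[of 0] sums_single[of 0 "\<lambda>_. v"] by (simp add: sums_unique2)
  qed
  moreover have "(x has_vector_derivative B (x s) + g) (at s)" for s
    unfolding has_vector_derivative_def
  proof (subst has_derivative_componentwise_within, rule ballI)
    fix b :: 'a assume "b \<in> Basis"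
    define a where "a k = (c k \<bullet> b) / fact k" for k
    have a_sums: "(\<lambda>k. a k * r ^ k) sums (x r \<bullet> b)" for r
      using bounded_linear.sums[OF bounded_linear_inner_left[of b] x_sums[of r]]
      by (simp add: a_def mult_ac)
    have "diffs a k * s ^ k = (s ^ k / fact k) * (c (Suc k) \<bullet> b)" for k
      by (simp add: diffs_def a_def del: of_nat_Suc)
    then have diffs: "(\<lambda>k. diffs a k * s ^ k) sums ((B (x s) + g) \<bullet> b)"
      using bounded_linear.sums[OF bounded_linear_inner_left[of b] x'_sums[of s]] by simp
    have "((\<lambda>r. \<Sum>k. a k * r ^ k) has_field_derivative (\<Sum>k. diffs a k * s ^ k)) (at s)"
      by (rule termdiffs_strong_converges_everywhere) (rule sums_summable[OF a_sums])
    then have "((\<lambda>r. x r \<bullet> b) has_field_derivative ((B (x s) + g) \<bullet> b)) (at s)"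
      by (simp add: sums_unique[OF a_sums, symmetric] sums_unique[OF diffs, symmetric])
    then show "((\<lambda>r. x r \<bullet> b) has_derivative (\<lambda>h. (h *\<^sub>R (B (x s) + g)) \<bullet> b)) (at s)"
      by (simp add: has_field_derivative_def mult_commute_abs)
  qed
  ultimately show ?thesis by (rule that)
qed

text \<open>
  This takes the place of Gronwall's inequality on a step so short that \<open>a \<tau> \<le> 1/2\<close>: if \<open>m\<close> is the
  maximum of \<open>\<parallel>h\<parallel>\<close>, the mean value inequality gives \<open>m \<le> \<tau> (a m + c) \<le> m/2 + c \<tau>\<close>.
\<close>

lemma short_time_bound:
  fixes h :: "real \<Rightarrow> 'a::real_normed_vector"
  assumes deriv: "\<And>s. s \<in> {t..t + \<tau>} \<Longrightarrow> (h has_vector_derivative h' s) (at s within {t..t + \<tau>})"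
    and start: "h t = 0"
    and growth: "\<And>s. s \<in> {t..t + \<tau>} \<Longrightarrow> norm (h' s) \<le> a * norm (h s) + c"
    and "0 \<le> a" "0 \<le> \<tau>" and short: "a * \<tau> \<le> 1 / 2"
  shows "norm (h (t + \<tau>)) \<le> 2 * c * \<tau>"
proof -
  let ?I = "{t..t + \<tau>}"
  have cont: "continuous_on ?I (\<lambda>s. norm (h s))"
    using deriv by (intro continuous_on_norm continuous_on_vector_derivative)
  obtain r where r: "r \<in> ?I" and max: "\<And>s. s \<in> ?I \<Longrightarrow> norm (h s) \<le> norm (h r)"
    using continuous_attains_sup[OF compact_Icc _ cont] \<open>0 \<le> \<tau>\<close> by auto
  have c: "0 \<le> a * norm (h r) + c"
    using growth[OF r] norm_ge_zero[of "h' r"] by linarith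
  have "norm (h r - h t) \<le> (a * norm (h r) + c) * norm (r - t)"
  proof (rule differentiable_bound[of ?I h "\<lambda>s d. d *\<^sub>R h' s"])
    show "(h has_derivative (\<lambda>d. d *\<^sub>R h' s)) (at s within ?I)" if "s \<in> ?I" for s
      using deriv[OF that] by (simp add: has_vector_derivative_def)
    show "onorm (\<lambda>d. d *\<^sub>R h' s) \<le> a * norm (h r) + c" if s: "s \<in> ?I" for s
    proof (rule onorm_bound)
      have "norm (h' s) \<le> a * norm (h r) + c"
        using growth[OF s] mult_left_mono[OF max[OF s] \<open>0 \<le> a\<close>] by linarith
      then show "norm (d *\<^sub>R h' s) \<le> (a * norm (h r) + c) * norm d" for d :: real
        by (simp add: mult.commute[of _ "\<bar>d\<bar>"] mult_left_mono)
    qed (rule c)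
  qed (use r \<open>0 \<le> \<tau>\<close> in auto)
  also have "\<dots> \<le> (a * norm (h r) + c) * \<tau>"
    using r by (intro mult_left_mono c) auto
  also have "\<dots> \<le> norm (h r) / 2 + c * \<tau>"
    using mult_right_mono[OF short, of "norm (h r)"] by (simp add: algebra_simps)
  finally have "norm (h r) \<le> 2 * c * \<tau>" using start by simp
  with max[of "t + \<tau>"] \<open>0 \<le> \<tau>\<close> show ?thesis by simp
qed

text \<open>The derivative is a limit of difference quotients, all of norm at most \<open>L\<close>.\<close>

lemma lipschitz_has_vector_derivative_norm_le:
  fixes y :: "real \<Rightarrow> 'a::real_normed_vector"
  assumes lip: "L-lipschitz_on S y" and deriv: "(y has_vector_derivative p) (at t within S)"
    and t: "t \<in> S" and "t islimpt S"
  shows "norm p \<le> L"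
proof (rule Lim_norm_ubound)
  have "((\<lambda>s. norm (y s - y t - (s - t) *\<^sub>R p) / norm (s - t)) \<longlongrightarrow> 0) (at t within S)"
    using deriv by (simp add: has_vector_derivative_def has_derivative_iff_norm)
  moreover have "\<forall>\<^sub>F s in at t within S. norm (y s - y t - (s - t) *\<^sub>R p) / norm (s - t)
      = norm (inverse (s - t) *\<^sub>R (y s - y t) - p)"
    unfolding eventually_at_filter
  proof (intro always_eventually allI impI)
    fix s assume "s \<noteq> t"
    then have "inverse (s - t) *\<^sub>R (y s - y t) - p = inverse (s - t) *\<^sub>R (y s - y t - (s - t) *\<^sub>R p)"
      by (simp add: scaleR_right_diff_distrib)
    then show "norm (y s - y t - (s - t) *\<^sub>R p) / norm (s - t)
        = norm (inverse (s - t) *\<^sub>R (y s - y t) - p)" by (simp only: norm_scaleR) (simp add: field_simps)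
  qed
  ultimately have "((\<lambda>s. norm (inverse (s - t) *\<^sub>R (y s - y t) - p)) \<longlongrightarrow> 0) (at t within S)"
    by (rule Lim_transform_eventually)
  then show "((\<lambda>s. inverse (s - t) *\<^sub>R (y s - y t)) \<longlongrightarrow> p) (at t within S)"
    by (rule LIM_zero_cancel[OF tendsto_norm_zero_cancel])
  show "\<forall>\<^sub>F s in at t within S. norm (inverse (s - t) *\<^sub>R (y s - y t)) \<le> L"
    unfolding eventually_at_filter
  proof (intro always_eventually allI impI)
    fix s assume "s \<noteq> t" "s \<in> S"
    then show "norm (inverse (s - t) *\<^sub>R (y s - y t)) \<le> L"
      using lipschitz_onD[OF lip \<open>s \<in> S\<close> t]
      by (simp only: norm_scaleR dist_norm) (simp add: field_simps)
  qed
qed (use assms in \<open>simp add: trivial_limit_within\<close>)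

section \<open>Componentwise products and matrix norms\<close>

text \<open>
  Multiplication on the type of vectors is componentwise, so polynomial identities for the
  nonlinearity become ring identities. The Euclidean norm is submultiplicative for it because each
  component of \<open>x\<close> is at most \<open>\<parallel>x\<parallel>\<close> in absolute value.
\<close>

lemma norm_times_cart_le:
  fixes x y :: "real ^ 'n"
  shows "norm (x * y) \<le> norm x * norm y"
proof -
  have "norm (x * y) \<le> norm (norm x *\<^sub>R y)"
    by (rule norm_le_componentwise_cart)
      (simp add: abs_mult mult_right_mono component_le_norm_cart)
  then show ?thesis by simp
qed

lemma norm_times_cart_mono:
  fixes x y :: "real ^ 'n"
  assumes "norm x \<le> a" "norm y \<le> b"
  shows "norm (x * y) \<le> a * b"
proof -
  have "0 \<le> a" using assms(1) norm_ge_zero order.trans by blast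
  with assms have "norm x * norm y \<le> a * b" by (intro mult_mono) auto
  with norm_times_cart_le show ?thesis by (rule order.trans)
qed

lemma norm_matrix_vector_mult_le: "norm (A *v x) \<le> matrix_norm A * norm x"
  unfolding matrix_norm_def by (rule onorm) simp

lemma matrix_norm_nonneg: "0 \<le> matrix_norm A"
  unfolding matrix_norm_def by (rule onorm_pos_le) simp

section \<open>The Cahn--Hilliard field and its linearization\<close>

lemma Fprime_eq: "Fprime y = y * y * y - y"
  by (simp add: Fprime_def vec_eq_iff power2_eq_square algebra_simps)

lemma Fprime_jacobian_mult: "Fprime_jacobian v *v x = 3 *\<^sub>R (v * v * x) - x"
proof -
  have "diag_mat d *v x = d * x" for d
    by (simp add: vec_eq_iff matrix_vector_mult_def diag_mat_def if_distrib[of "\<lambda>z. z * _"]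
        cong: if_cong)
  moreover have "(3 *\<^sub>R diag_mat (\<chi> i. (v $ i)\<^sup>2)) *v x = 3 *\<^sub>R (diag_mat (\<chi> i. (v $ i)\<^sup>2) *v x)"
    by (rule scaleR_matrix_vector_assoc[symmetric])
  ultimately show ?thesis
    by (simp add: Fprime_jacobian_def matrix_vector_mult_diff_rdistrib vec_eq_iff power2_eq_square)
qed

lemma EE2_matrix_mult:
  "EE2_matrix A \<epsilon> v *v x = A *v (3 *\<^sub>R (v * v * x) - x + \<epsilon>\<^sup>2 *\<^sub>R (A *v x))"
  by (simp add: EE2_matrix_def matrix_vector_mul_assoc[symmetric] matrix_vector_mult_add_rdistrib
      Fprime_jacobian_mult scaleR_matrix_vector_assoc[symmetric])

text \<open>
  A common bound, for states of norm at most \<open>V\<close>, of the Jacobian \<open>A (J + \<epsilon>\<^sup>2 A)\<close> and of the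
  Lipschitz constant of the field.
\<close>

definition stiffness :: "real ^ 'n ^ 'n \<Rightarrow> real \<Rightarrow> real \<Rightarrow> real"
  where "stiffness A \<epsilon> V = matrix_norm A * (3 * V\<^sup>2 + 1 + \<epsilon>\<^sup>2 * matrix_norm A)"

lemma stiffness_nonneg: "0 \<le> stiffness A \<epsilon> V"
  by (simp add: stiffness_def matrix_norm_nonneg)

text \<open>
  Both the Jacobian at \<open>v\<close> (with \<open>m = 3 v\<^sup>2\<close>) and the difference quotient of the field between
  \<open>x\<close> and \<open>z\<close> (with \<open>m = x\<^sup>2 + x z + z\<^sup>2\<close>) have this form, which is why the factor \<open>m\<close> is left
  general.
\<close>

lemma norm_linearized_field_le:
  fixes m x :: "real ^ 'n"
  assumes "norm m \<le> 3 * V\<^sup>2"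
  shows "norm (A *v (m * x - x + \<epsilon>\<^sup>2 *\<^sub>R (A *v x)))
    \<le> stiffness A \<epsilon> V * norm x"
proof -
  have "norm (m * x - x + \<epsilon>\<^sup>2 *\<^sub>R (A *v x)) \<le> norm m * norm x + norm x + \<epsilon>\<^sup>2 * norm (A *v x)"
    using norm_triangle_ineq[of "m * x - x" "\<epsilon>\<^sup>2 *\<^sub>R (A *v x)"] norm_triangle_ineq4[of "m * x" x]
      norm_times_cart_le[of m x] by simp
  also have "\<dots> \<le> 3 * V\<^sup>2 * norm x + norm x + \<epsilon>\<^sup>2 * (matrix_norm A * norm x)"
    using assms by (intro add_mono mult_mono norm_matrix_vector_mult_le) auto
  finally have "norm (m * x - x + \<epsilon>\<^sup>2 *\<^sub>R (A *v x))
      \<le> (3 * V\<^sup>2 + 1 + \<epsilon>\<^sup>2 * matrix_norm A) * norm x" by (simp add: algebra_simps)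
  from order.trans[OF norm_matrix_vector_mult_le mult_left_mono[OF this matrix_norm_nonneg]]
  show ?thesis by (simp add: stiffness_def mult_ac)
qed

lemma EE2_matrix_bound:
  assumes "norm v \<le> V"
  shows "norm (EE2_matrix A \<epsilon> v *v x)
    \<le> stiffness A \<epsilon> V * norm x"
proof -
  have "norm (v * v) \<le> V\<^sup>2"
    using norm_times_cart_mono[OF assms assms] by (simp add: power2_eq_square)
  then show ?thesis
    using norm_linearized_field_le[of "3 *\<^sub>R (v * v)" V A x \<epsilon>] by (simp add: EE2_matrix_mult)
qed

definition CH_field :: "real ^ 'n ^ 'n \<Rightarrow> real \<Rightarrow> real ^ 'n \<Rightarrow> real ^ 'n"
  where "CH_field A \<epsilon> y = - (A *v (Fprime y + \<epsilon>\<^sup>2 *\<^sub>R (A *v y)))"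

lemma CH_field_lipschitz:
  assumes "norm x \<le> V" "norm z \<le> V"
  shows "norm (CH_field A \<epsilon> x - CH_field A \<epsilon> z)
    \<le> stiffness A \<epsilon> V * norm (x - z)"
proof -
  have sq: "norm (a * b) \<le> V\<^sup>2" if "norm a \<le> V" "norm b \<le> V" for a b :: "real ^ 'n"
    using norm_times_cart_mono[OF that] by (simp add: power2_eq_square)
  have "norm (x * x + x * z + z * z) \<le> 3 * V\<^sup>2"
    using sq[OF assms(1) assms(1)] sq[OF assms] sq[OF assms(2) assms(2)]
      norm_triangle_ineq[of "x * x + x * z" "z * z"] norm_triangle_ineq[of "x * x" "x * z"] by linarith
  moreover have "Fprime x - Fprime z = (x * x + x * z + z * z) * (x - z) - (x - z)"
    by (simp add: Fprime_eq algebra_simps)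
  then have "CH_field A \<epsilon> x - CH_field A \<epsilon> z =
      - (A *v ((x * x + x * z + z * z) * (x - z) - (x - z) + \<epsilon>\<^sup>2 *\<^sub>R (A *v (x - z))))"
    unfolding CH_field_def
    by (metis (no_types) minus_diff_minus matrix_vector_mult_diff_distrib scaleR_right_diff_distrib
      add_diff_add)
  ultimately show ?thesis using norm_linearized_field_le by simp
qed

text \<open>The field is a cubic polynomial, so its Taylor expansion is finite and exact.\<close>

lemma CH_field_taylor:
  "CH_field A \<epsilon> (v + d) = CH_field A \<epsilon> v - EE2_matrix A \<epsilon> v *v d
    - A *v (3 *\<^sub>R (v * d * d) + d * d * d)"
proof -
  have "(v + d) * (v + d) * (v + d) = v * v * v + 3 *\<^sub>R (v * v * d) + 3 *\<^sub>R (v * d * d) + d * d * d"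
    by (simp add: vec_eq_iff algebra_simps)
  then show ?thesis
    by (simp add: CH_field_def Fprime_eq EE2_matrix_mult matrix_vector_right_distrib
       matrix_vector_mult_diff_distrib scaleR_right_distrib algebra_simps)
qed

text \<open>
  The right-hand side of the scheme is the first-order Taylor polynomial of the field at \<open>v\<close>; this is
  what the choice of the constant vector in the scheme achieves.
\<close>

lemma EE2_rhs:
  "- (EE2_matrix A \<epsilon> v *v u) + EE2_vector A v = CH_field A \<epsilon> v - EE2_matrix A \<epsilon> v *v (u - v)"
  by (simp add: CH_field_def Fprime_eq EE2_matrix_mult EE2_vector_def Fprime_jacobian_mult
      matrix_vector_right_distrib matrix_vector_mult_diff_distrib
       scaleR_right_distrib scaleR_right_diff_distrib algebra_simps)

section \<open>The step of the scheme is well defined\<close>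

lemma EE2_ivp_solution:
  fixes v :: "real ^ 'n"
  assumes "norm v \<le> V" "0 \<le> \<tau>"
    and short: "stiffness A \<epsilon> V * \<tau> \<le> 1 / 2"
  obtains u where "EE2_ivp A \<epsilon> t \<tau> v u" "EE2_step A \<epsilon> t \<tau> v = u (t + \<tau>)"
proof -
  let ?B = "EE2_matrix A \<epsilon> v" and ?I = "{t..t + \<tau>}"
  have "bounded_linear (\<lambda>x. - (?B *v x))" by (intro bounded_linear_minus) simp
  from affine_ode_solution_exists[OF this, of v "EE2_vector A v"]
  obtain x where x0: "x 0 = v"
    and x': "\<And>s. (x has_vector_derivative - (?B *v x s) + EE2_vector A v) (at s)"
    by blast
  define u where "u s = x (s - t)" for s
  have "(u has_vector_derivative - (?B *v u s) + EE2_vector A v) (at s)" for s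
  proof -
    have "((\<lambda>s. s - t) has_vector_derivative 1) (at s)"
      by (auto intro!: derivative_eq_intros)
    from vector_diff_chain_at[OF this x'] show ?thesis by (simp add: u_def[abs_def] o_def)
  qed
  then have u: "EE2_ivp A \<epsilon> t \<tau> v u"
    by (auto simp: EE2_ivp_def u_def x0 intro: has_vector_derivative_at_within)
  have unique: "u' (t + \<tau>) = u (t + \<tau>)" if u': "EE2_ivp A \<epsilon> t \<tau> v u'" for u'
  proof -
    have "norm (u' (t + \<tau>) - u (t + \<tau>)) \<le> 2 * 0 * \<tau>"
    proof (rule short_time_bound[OF _ _ _ _ \<open>0 \<le> \<tau>\<close> short])
      show "((\<lambda>s. u' s - u s) has_vector_derivative - (?B *v (u' s - u s))) (at s within ?I)"
        if "s \<in> ?I" for s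
      proof -
        have "((\<lambda>s. u' s - u s) has_vector_derivative
            (- (?B *v u' s) + EE2_vector A v) - (- (?B *v u s) + EE2_vector A v)) (at s within ?I)"
          using u u' that by (intro has_vector_derivative_diff) (auto simp: EE2_ivp_def)
        then show ?thesis by (simp add: matrix_vector_mult_diff_distrib)
      qed
      show "u' t - u t = 0" using u u' by (simp add: EE2_ivp_def)
      show "norm (- (?B *v (u' s - u s)))
          \<le> stiffness A \<epsilon> V * norm (u' s - u s) + 0" for s
        using EE2_matrix_bound[OF assms(1), of A \<epsilon> "u' s - u s"] by simp
    qed (rule stiffness_nonneg)
    then show ?thesis by simp
  qed
  have "EE2_step A \<epsilon> t \<tau> v = u (t + \<tau>)"
    unfolding EE2_step_def by (rule the_equality) (use u unique in blast)+
  with u show ?thesis by (rule that)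
qed

section \<open>Expansion of the local error\<close>

text \<open>
  If \<open>d\<close> agrees with \<open>s p\<close> up to \<open>k s\<^sup>2\<close>, then \<open>d\<^sup>2 - s\<^sup>2 p\<^sup>2 = (d - s p)(d + s p)\<close> is of order \<open>s\<^sup>3\<close>,
  just as \<open>d\<^sup>3\<close> is.
\<close>

lemma quadratic_remainder_bound:
  fixes v d p :: "real ^ 'n"
  assumes "norm v \<le> V" "norm p \<le> L" "0 \<le> s"
    and d: "norm d \<le> L * s" and lin: "norm (d - s *\<^sub>R p) \<le> k * s\<^sup>2"
  shows "norm (3 *\<^sub>R (v * d * d) + d * d * d - (3 * s\<^sup>2) *\<^sub>R (v * p * p))
    \<le> (6 * V * k * L + L ^ 3) * s ^ 3"
proof -
  have plus: "norm (d + s *\<^sub>R p) \<le> 2 * L * s"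
    using norm_triangle_ineq[of d "s *\<^sub>R p"] d mult_right_mono[OF assms(2,3)] \<open>0 \<le> s\<close>
    by (simp add: mult_ac)
  have 1: "norm (v * ((d - s *\<^sub>R p) * (d + s *\<^sub>R p))) \<le> V * (k * s\<^sup>2 * (2 * L * s))"
    by (intro norm_times_cart_mono assms(1) lin plus)
  have 2: "norm (d * (d * d)) \<le> (L * s) * ((L * s) * (L * s))"
    by (intro norm_times_cart_mono d)
  have eq: "3 *\<^sub>R (v * d * d) + d * d * d - (3 * s\<^sup>2) *\<^sub>R (v * p * p)
      = 3 *\<^sub>R (v * ((d - s *\<^sub>R p) * (d + s *\<^sub>R p))) + d * (d * d)"
    by (simp add: vec_eq_iff power2_eq_square algebra_simps)
  have "norm (3 *\<^sub>R (v * ((d - s *\<^sub>R p) * (d + s *\<^sub>R p))) + d * (d * d))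
      \<le> 3 * norm (v * ((d - s *\<^sub>R p) * (d + s *\<^sub>R p))) + norm (d * (d * d))"
    by (rule order.trans[OF norm_triangle_ineq]) simp
  also have "\<dots> \<le> 3 * (V * (k * s\<^sup>2 * (2 * L * s))) + (L * s) * ((L * s) * (L * s))"
    using 1 2 by linarith
  also have "\<dots> = (6 * V * k * L + L ^ 3) * s ^ 3"
    by (simp add: power2_eq_square power3_eq_cube algebra_simps)
  finally show ?thesis unfolding eq .
qed

lemma cahn_hilliard_solution_deriv:
  assumes "cahn_hilliard_solution A \<epsilon> y0 T y" "t \<in> {0..T}"
  shows "(y has_vector_derivative CH_field A \<epsilon> (y t)) (at t within {0..T})"
  using assms unfolding cahn_hilliard_solution_def CH_field_def by blast

text \<open>
  The Lipschitz constant of the trajectory bounds the field along it independently of \<open>A\<close> and \<open>\<epsilon>\<close>.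
  A bound through the formula for the field would contain both, and the leading coefficient would then
  no longer be bounded by a multiple of \<open>\<parallel>A\<parallel>\<close> that is uniform in \<open>A\<close>.
\<close>

lemma norm_CH_field_along_solution_le:
  assumes sol: "cahn_hilliard_solution A \<epsilon> y0 T y" and lip: "L-lipschitz_on {0..T} y"
    and "0 < T" and t: "t \<in> {0..T}"
  shows "norm (CH_field A \<epsilon> (y t)) \<le> L"
  using lip cahn_hilliard_solution_deriv[OF sol t] t
  by (rule lipschitz_has_vector_derivative_norm_le) (use t \<open>0 < T\<close> in \<open>simp add: islimpt_Icc\<close>)

lemma norm_leading_coefficient_le:
  assumes "norm v \<le> V" "norm p \<le> L"
  shows "norm (A *v (v * p * p)) \<le> matrix_norm A * (V * L * L)"
  by (intro order.trans[OF norm_matrix_vector_mult_le] mult_left_mono matrix_norm_nonneg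
      norm_times_cart_mono assms)

text \<open>
  With \<open>q = A (v p\<^sup>2)\<close>, the corrected error \<open>h = y - u + (s - t)\<^sup>3 q\<close> has derivative
  \<open>-A R - B (h - (s - t)\<^sup>3 q)\<close>, where \<open>B\<close> is the matrix of the scheme and \<open>R\<close> is what remains of
  \<open>3 v d\<^sup>2 + d\<^sup>3\<close> after the derivative \<open>3 (s - t)\<^sup>2 q\<close> of the correction has cancelled the quadratic
  part. Both \<open>A R\<close> and \<open>(s - t)\<^sup>3 B q\<close> are of order \<open>\<tau>\<^sup>3\<close>.
\<close>

lemma EE2_local_error_expansion:
  fixes A :: "real ^ 'n ^ 'n" and V \<epsilon> :: real
  defines "a \<equiv> stiffness A \<epsilon> V"
  assumes sol: "cahn_hilliard_solution A \<epsilon> y0 T y" and lip: "L-lipschitz_on {0..T} y"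
    and V: "\<And>s. s \<in> {0..T} \<Longrightarrow> norm (y s) \<le> V"
    and t: "t \<in> {0..T - \<tau>}" and "0 < \<tau>" and short: "a * \<tau> \<le> 1 / 2"
  shows "norm (EE2_local_error A \<epsilon> y t \<tau>
      + \<tau> ^ 3 *\<^sub>R (A *v (y t * CH_field A \<epsilon> (y t) * CH_field A \<epsilon> (y t))))
    \<le> 2 * (matrix_norm A * (6 * V * (a * L) * L + L ^ 3) + a * (matrix_norm A * (V * L * L))) * \<tau> ^ 4"
proof -
  let ?I = "{t..t + \<tau>}" and ?B = "EE2_matrix A \<epsilon> (y t)" and ?n = "matrix_norm A"
  define p where "p = CH_field A \<epsilon> (y t)"
  define q where "q = A *v (y t * p * p)"
  have I: "?I \<subseteq> {0..T}" and tT: "t \<in> {0..T}" using t \<open>0 < \<tau>\<close> by auto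
  have L: "0 \<le> L" by (rule lipschitz_on_nonneg[OF lip])
  have V0: "0 \<le> V" using V[OF tT] norm_ge_zero order.trans by blast
  have a: "0 \<le> a" unfolding a_def by (rule stiffness_nonneg)
  have B: "norm (?B *v x) \<le> a * norm x" for x
    unfolding a_def by (rule EE2_matrix_bound[OF V[OF tT]])
  note y' = cahn_hilliard_solution_deriv[OF sol]
  have dist: "norm (y s - y t) \<le> L * (s - t)" if "s \<in> ?I" for s
    using lipschitz_onD[OF lip, of s t] that I tT by (auto simp: dist_norm)
  have p: "norm p \<le> L"
    unfolding p_def using t \<open>0 < \<tau>\<close> by (intro norm_CH_field_along_solution_le[OF sol lip _ tT]) simp
  have lin: "norm (y s - y t - (s - t) *\<^sub>R p) \<le> a * L * (s - t)\<^sup>2" if s: "s \<in> ?I" for s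
  proof -
    have "norm (y s - y t - (s - t) *\<^sub>R p) \<le> norm (s - t) * (a * (L * (s - t)))"
      unfolding p_def
    proof (rule vector_differentiable_bound_linearization[where S = "{t..s}" and f = y])
      show "(y has_vector_derivative CH_field A \<epsilon> (y r)) (at r within {t..s})" if "r \<in> {t..s}" for r
        using s that I by (intro has_vector_derivative_within_subset[OF y']) auto
      show "norm (CH_field A \<epsilon> (y r) - CH_field A \<epsilon> (y t)) \<le> a * (L * (s - t))" if r: "r \<in> {t..s}" for r
      proof -
        have rI: "r \<in> ?I" using r s by auto
        have "norm (CH_field A \<epsilon> (y r) - CH_field A \<epsilon> (y t)) \<le> a * norm (y r - y t)"
          unfolding a_def using rI I by (intro CH_field_lipschitz V tT) auto
        also have "\<dots> \<le> a * (L * (s - t))"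
          using r by (intro mult_left_mono[OF _ a] order.trans[OF dist[OF rI]] mult_left_mono L) auto
        finally show ?thesis .
      qed
    qed (use s in \<open>auto simp: closed_segment_eq_real_ivl\<close>)
    then show ?thesis using s by (simp add: power2_eq_square mult_ac)
  qed
  have q: "norm q \<le> ?n * (V * L * L)"
    unfolding q_def by (rule norm_leading_coefficient_le[OF V[OF tT] p])
  obtain u where u: "EE2_ivp A \<epsilon> t \<tau> (y t) u" and step: "EE2_step A \<epsilon> t \<tau> (y t) = u (t + \<tau>)"
    using EE2_ivp_solution[OF V[OF tT], of \<tau> A \<epsilon> t] \<open>0 < \<tau>\<close> short unfolding a_def by auto
  define h where "h s = y s - u s + (s - t) ^ 3 *\<^sub>R q" for s
  define R where "R s = 3 *\<^sub>R (y t * (y s - y t) * (y s - y t))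
    + (y s - y t) * (y s - y t) * (y s - y t) - (3 * (s - t)\<^sup>2) *\<^sub>R (y t * p * p)" for s
  define h' where "h' s = - (A *v R s) - ?B *v (h s - (s - t) ^ 3 *\<^sub>R q)" for s
  define c where "c = ?n * ((6 * V * (a * L) * L + L ^ 3) * \<tau> ^ 3) + a * (\<tau> ^ 3 * (?n * (V * L * L)))"
  have "norm (h (t + \<tau>)) \<le> 2 * c * \<tau>"
  proof (rule short_time_bound[OF _ _ _ a _ short])
    show "h t = 0" using u by (simp add: h_def EE2_ivp_def)
    fix s assume s: "s \<in> ?I"
    have cube: "(s - t) ^ 3 \<le> \<tau> ^ 3" using s by (intro power_mono) auto
    have "((\<lambda>s. (s - t) ^ 3 *\<^sub>R q) has_vector_derivative (3 * (s - t)\<^sup>2) *\<^sub>R q) (at s within ?I)"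
      by (auto intro!: derivative_eq_intros)
    moreover have "(y has_vector_derivative CH_field A \<epsilon> (y s)) (at s within ?I)"
      using s I by (intro has_vector_derivative_within_subset[OF y']) auto
    moreover have "(u has_vector_derivative p - ?B *v (u s - y t)) (at s within ?I)"
      using u s unfolding p_def EE2_rhs[symmetric] EE2_ivp_def by blast
    ultimately have "(h has_vector_derivative
        CH_field A \<epsilon> (y s) - (p - ?B *v (u s - y t)) + (3 * (s - t)\<^sup>2) *\<^sub>R q) (at s within ?I)"
      unfolding h_def by (intro has_vector_derivative_add has_vector_derivative_diff)
    moreover have "CH_field A \<epsilon> (y s) - (p - ?B *v (u s - y t)) + (3 * (s - t)\<^sup>2) *\<^sub>R q = h' s"
      using CH_field_taylor[of A \<epsilon> "y t" "y s - y t"]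
      by (simp add: h'_def h_def R_def p_def q_def matrix_vector_mult_diff_distrib
          matrix_vector_right_distrib matrix_vector_mult_scaleR)
    ultimately show "(h has_vector_derivative h' s) (at s within ?I)" by simp
    have "norm (R s) \<le> (6 * V * (a * L) * L + L ^ 3) * (s - t) ^ 3"
      unfolding R_def
      by (rule quadratic_remainder_bound[OF V[OF tT] p _ dist[OF s] lin[OF s]]) (use s in simp)
    also have "\<dots> \<le> (6 * V * (a * L) * L + L ^ 3) * \<tau> ^ 3"
      using V0 a L by (intro mult_left_mono cube) auto
    finally have 1: "norm (A *v R s) \<le> ?n * ((6 * V * (a * L) * L + L ^ 3) * \<tau> ^ 3)"
      by (intro order.trans[OF norm_matrix_vector_mult_le] mult_left_mono matrix_norm_nonneg)
    have "norm ((s - t) ^ 3 *\<^sub>R q) \<le> \<tau> ^ 3 * (?n * (V * L * L))"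
      using s \<open>0 < \<tau>\<close> mult_mono[OF cube q] by simp
    then have "norm (h s - (s - t) ^ 3 *\<^sub>R q) \<le> norm (h s) + \<tau> ^ 3 * (?n * (V * L * L))"
      using norm_triangle_ineq4[of "h s" "(s - t) ^ 3 *\<^sub>R q"] by linarith
    from order.trans[OF B mult_left_mono[OF this a]]
    have 2: "norm (?B *v (h s - (s - t) ^ 3 *\<^sub>R q)) \<le> a * norm (h s) + a * (\<tau> ^ 3 * (?n * (V * L * L)))"
      by (simp add: distrib_left)
    have "norm (h' s) \<le> norm (A *v R s) + norm (?B *v (h s - (s - t) ^ 3 *\<^sub>R q))"
      unfolding h'_def using norm_triangle_ineq4[of "- (A *v R s)"] by simp
    then show "norm (h' s) \<le> a * norm (h s) + c" using 1 2 unfolding c_def by linarith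
  qed (use \<open>0 < \<tau>\<close> in simp)
  moreover have "2 * c * \<tau>
      = 2 * (?n * (6 * V * (a * L) * L + L ^ 3) + a * (?n * (V * L * L))) * \<tau> ^ 4"
    by (simp add: c_def power3_eq_cube power4_eq_xxxx algebra_simps)
  ultimately show ?thesis
    by (simp add: h_def step EE2_local_error_def p_def q_def)
qed

theorem proposition3:
  fixes y0 :: "real ^ 'n" and T L :: real
  assumes "0 < T"
  shows "\<exists>C. \<forall>(A :: real ^ 'n ^ 'n) (\<epsilon> :: real) (y :: real \<Rightarrow> real ^ 'n).
    psd_matrix A \<and> 0 < \<epsilon> \<and> cahn_hilliard_solution A \<epsilon> y0 T y \<and> L-lipschitz_on {0..T} y \<longrightarrow>
      (\<exists>K. \<forall>\<^sub>F \<tau> in at_right 0. \<forall>t\<in>{0..T - \<tau>}.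
        norm (EE2_local_error A \<epsilon> y t \<tau>) \<le> K * \<tau> ^ 3) \<and>
      (\<exists>w K. (\<forall>t\<in>{0..T}. norm (w t) \<le> C) \<and>
        (\<forall>\<^sub>F \<tau> in at_right 0. \<forall>t\<in>{0..T - \<tau>}.
          norm (EE2_local_error A \<epsilon> y t \<tau> - (matrix_norm A * \<tau> ^ 3) *\<^sub>R w t) \<le> K * \<tau> ^ 4))"
proof (intro exI[of _ "(norm y0 + L * T) * L * L"] allI impI)
  fix A :: "real ^ 'n ^ 'n" and \<epsilon> :: real and y :: "real \<Rightarrow> real ^ 'n"
  assume "psd_matrix A \<and> 0 < \<epsilon> \<and> cahn_hilliard_solution A \<epsilon> y0 T y \<and> L-lipschitz_on {0..T} y"
  then have sol: "cahn_hilliard_solution A \<epsilon> y0 T y" and lip: "L-lipschitz_on {0..T} y" by auto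
  define V where "V = norm y0 + L * T"
  define a where "a = stiffness A \<epsilon> V"
  define C where "C = V * L * L"
  define K where "K = 2 * (matrix_norm A * (6 * V * (a * L) * L + L ^ 3) + a * (matrix_norm A * C))"
  define p where "p t = CH_field A \<epsilon> (y t)" for t
  define w where "w t = - (inverse (matrix_norm A) *\<^sub>R (A *v (y t * p t * p t)))" for t
  have L: "0 \<le> L" by (rule lipschitz_on_nonneg[OF lip])
  have V: "norm (y t) \<le> V" if "t \<in> {0..T}" for t
  proof -
    have "norm (y t - y 0) \<le> L * t"
      using lipschitz_onD[OF lip that, of 0] \<open>0 < T\<close> that by (simp add: dist_norm)
    also have "\<dots> \<le> L * T" using that L by (intro mult_left_mono) auto
    finally show ?thesis
      using norm_triangle_sub[of "y t" "y 0"] sol by (simp add: V_def cahn_hilliard_solution_def)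
  qed
  have V0: "0 \<le> V" using L \<open>0 < T\<close> by (simp add: V_def)
  have a: "0 \<le> a" unfolding a_def by (rule stiffness_nonneg)
  have K: "0 \<le> K" unfolding K_def C_def using V0 L a by (simp add: matrix_norm_nonneg)
  have w: "norm (w t) \<le> C" if t: "t \<in> {0..T}" for t
  proof -
    have "norm (A *v (y t * p t * p t)) \<le> matrix_norm A * C"
      unfolding C_def p_def
      by (rule norm_leading_coefficient_le[OF V[OF t] norm_CH_field_along_solution_le[OF sol lip \<open>0 < T\<close> t]])
    then have "norm (w t) \<le> inverse (matrix_norm A) * (matrix_norm A * C)"
      unfolding w_def by (simp add: matrix_norm_nonneg mult_left_mono)
    also have "\<dots> \<le> C" using V0 L by (cases "matrix_norm A = 0") (simp_all add: C_def mult.assoc[symmetric])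
    finally show ?thesis .
  qed
  \<comment> \<open>If \<open>\<parallel>A\<parallel> = 0\<close>, both sides vanish, since \<open>A\<close> is then zero as a linear map.\<close>
  have scaled_w: "matrix_norm A *\<^sub>R w t = - (A *v (y t * p t * p t))" for t
  proof (cases "matrix_norm A = 0")
    case True
    then show ?thesis using norm_matrix_vector_mult_le[of A "y t * p t * p t"] by simp
  qed (simp add: w_def)
  have expansion: "norm (EE2_local_error A \<epsilon> y t \<tau> - (matrix_norm A * \<tau> ^ 3) *\<^sub>R w t) \<le> K * \<tau> ^ 4"
    if "0 < \<tau>" "a * \<tau> \<le> 1 / 2" "t \<in> {0..T - \<tau>}" for t \<tau>
  proof -
    have "(matrix_norm A * \<tau> ^ 3) *\<^sub>R w t = - (\<tau> ^ 3 *\<^sub>R (A *v (y t * p t * p t)))"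
      using arg_cong[OF scaled_w, of "\<lambda>x. \<tau> ^ 3 *\<^sub>R x" t] by (simp add: mult.commute)
    then show ?thesis
      using EE2_local_error_expansion[OF sol lip V that(3,1) that(2)[unfolded a_def]]
      by (simp add: K_def C_def a_def p_def)
  qed
  \<comment> \<open>The bound \<open>\<tau> \<le> 1\<close> allows \<open>\<tau>\<^sup>4\<close> to be absorbed into \<open>\<tau>\<^sup>3\<close> in the first claim.\<close>
  have small: "\<forall>\<^sub>F \<tau> in at_right 0. 0 < \<tau> \<and> a * \<tau> \<le> 1 / 2 \<and> \<tau> \<le> 1"
  proof -
    have "0 < min 1 (1 / (2 * (a + 1)))" using a by simp
    then have "\<forall>\<^sub>F \<tau> in at_right 0. \<tau> \<in> {0<..<min 1 (1 / (2 * (a + 1)))}"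
      by (rule eventually_at_right_real)
    then show ?thesis
    proof eventually_elim
      case (elim \<tau>)
      then have "(a + 1) * \<tau> \<le> 1 / 2" using a by (simp add: field_simps)
      then show ?case using elim by (simp add: algebra_simps)
    qed
  qed
  have second: "\<forall>\<^sub>F \<tau> in at_right 0. \<forall>t\<in>{0..T - \<tau>}.
      norm (EE2_local_error A \<epsilon> y t \<tau> - (matrix_norm A * \<tau> ^ 3) *\<^sub>R w t) \<le> K * \<tau> ^ 4"
    using small by eventually_elim (use expansion in blast)
  have first: "\<forall>\<^sub>F \<tau> in at_right 0. \<forall>t\<in>{0..T - \<tau>}.
      norm (EE2_local_error A \<epsilon> y t \<tau>) \<le> (K + matrix_norm A * C) * \<tau> ^ 3"
    using small
  proof (rule eventually_mono, intro ballI)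
    fix \<tau> t assume \<tau>: "0 < \<tau> \<and> a * \<tau> \<le> 1 / 2 \<and> \<tau> \<le> 1" and t: "t \<in> {0..T - \<tau>}"
    have "K * \<tau> ^ 4 \<le> K * \<tau> ^ 3"
      using \<tau> by (intro mult_left_mono K power_decreasing) auto
    moreover have "norm ((matrix_norm A * \<tau> ^ 3) *\<^sub>R w t) \<le> matrix_norm A * C * \<tau> ^ 3"
      using \<tau> t mult_left_mono[OF w[of t], of "matrix_norm A * \<tau> ^ 3"]
      by (simp add: abs_mult matrix_norm_nonneg mult_ac)
    ultimately show "norm (EE2_local_error A \<epsilon> y t \<tau>) \<le> (K + matrix_norm A * C) * \<tau> ^ 3"
      using expansion[of \<tau> t] \<tau> t
        norm_triangle_sub[of "EE2_local_error A \<epsilon> y t \<tau>" "(matrix_norm A * \<tau> ^ 3) *\<^sub>R w t"]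
      by (simp add: distrib_right)
  qed
  show "(\<exists>K. \<forall>\<^sub>F \<tau> in at_right 0. \<forall>t\<in>{0..T - \<tau>}.
        norm (EE2_local_error A \<epsilon> y t \<tau>) \<le> K * \<tau> ^ 3) \<and>
      (\<exists>w K. (\<forall>t\<in>{0..T}. norm (w t) \<le> (norm y0 + L * T) * L * L) \<and>
        (\<forall>\<^sub>F \<tau> in at_right 0. \<forall>t\<in>{0..T - \<tau>}.
          norm (EE2_local_error A \<epsilon> y t \<tau> - (matrix_norm A * \<tau> ^ 3) *\<^sub>R w t) \<le> K * \<tau> ^ 4))"
    using first second w unfolding C_def V_def by blast
qed

end
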